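(* Let $a,b,c$ be real numbers, not all zero, and let $\{\mathcal{J}g_{-n}^{(3)}\}_{n\geq 0}$ be the generalized Gaussian third-order Jacobsthal numbers with negative subscript with parameters $a,b,c$. Then for every integer $n\geq 1$, $$ \mathcal{J}g_{-n}^{(3)}=\frac{1}{7}\Big\{(a+b+c)\left(1+\tfrac{i}{2}\right)\left(\tfrac12\right)^{n}-\left[4a+4b-3c+(2a-5b+2c)i\right]\Omega_{n}-\left[6a-b-c-(4a+4b-3c)i\right]\Omega_{n-1}\Big\} $$ and $$ \mathcal{J}g_{-n}^{(3)}=\frac{1}{7}\Big\{(a+b+c)\left(1+\tfrac{i}{2}\right)\left(\tfrac12\right)^{n}+\left[2a-5b+2c-(6a-b-c)i\right]\Omega_{n}+\left[6a-b-c-(4a+4b-3c)i\right]\Omega_{n+1}\Big\}. $$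
   Context: Here $i$ is the imaginary unit. The generalized Gaussian third-order Jacobsthal numbers with negative subscript, with real parameters $a,b,c$ (not all zero), are the complex numbers defined recursively by $\mathcal{J}g_{-(n+3)}^{(3)}=\frac{1}{2}\left[-\mathcal{J}g_{-(n+2)}^{(3)}-\mathcal{J}g_{-(n+1)}^{(3)}+\mathcal{J}g_{-n}^{(3)}\right]$ for $n\ge 0$, with initial values $\mathcal{J}g_{0}^{(3)}=a+\frac{1}{2}(c-b-a)i$, $\mathcal{J}g_{-1}^{(3)}=\frac{1}{2}(c-b-a)-\frac{1}{4}(a-3b+c)i$ and $\mathcal{J}g_{-2}^{(3)}=-\frac{1}{4}(a-3b+c)+\frac{1}{8}(7a-b-c)i$. For an integer $n$, $\Omega_{n}=\frac{\omega_1^n-\omega_2^n}{\omega_1-\omega_2}$, where $\omega_1,\omega_2$ are the roots of $x^2+x+1=0$; equivalently $\Omega_n=0,1,-1$ according as $n\equiv 0,1,2 \pmod 3$. *)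

theory Defs
  imports Complex_Main
begin

text \<open>Only the non-positive part of the index range is defined: \<open>Jg_neg a b c n\<close> is the term
  with subscript \<open>-n\<close>.\<close>

fun Jg_neg :: "real \<Rightarrow> real \<Rightarrow> real \<Rightarrow> nat \<Rightarrow> complex" where
  "Jg_neg a b c 0 =
     complex_of_real a + 1/2 * complex_of_real (c - b - a) * \<i>"
| "Jg_neg a b c (Suc 0) =
     1/2 * complex_of_real (c - b - a) - 1/4 * complex_of_real (a - 3*b + c) * \<i>"
| "Jg_neg a b c (Suc (Suc 0)) =
     - (1/4) * complex_of_real (a - 3*b + c) + 1/8 * complex_of_real (7*a - b - c) * \<i>"
| "Jg_neg a b c (Suc (Suc (Suc n))) =
     1/2 * (- Jg_neg a b c (Suc (Suc n)) - Jg_neg a b c (Suc n) + Jg_neg a b c n)"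

definition omega1 :: complex where
  "omega1 = (- 1 + \<i> * complex_of_real (sqrt 3)) / 2"

definition omega2 :: complex where
  "omega2 = (- 1 - \<i> * complex_of_real (sqrt 3)) / 2"

lemma omega_roots: "x^2 + x + 1 = 0 \<longleftrightarrow> x = omega1 \<or> x = omega2" for x :: complex
proof -
  have s: "complex_of_real (sqrt 3) * complex_of_real (sqrt 3) = 3"
    by (simp flip: of_real_mult)
  have "omega1 + omega2 = -1"
    by (simp add: omega1_def omega2_def field_simps)
  moreover have "omega1 * omega2 = 1"
    using s by (simp add: omega1_def omega2_def algebra_simps)
  ultimately have "x^2 + x + 1 = (x - omega1) * (x - omega2)"
    by algebra
  then show ?thesis by simp
qed

lemma omega1_neq_omega2: "omega1 \<noteq> omega2"
  by (simp add: omega1_def omega2_def complex_eq_iff)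

text \<open>The index is an integer and \<open>powi\<close> the integer power, so \<open>Omega\<close> also makes sense
  at negative indices. The value does not depend on which root is called \<open>omega1\<close>.\<close>

definition Omega :: "int \<Rightarrow> complex" where
  "Omega n = (omega1 powi n - omega2 powi n) / (omega1 - omega2)"

end

theory Submission
  imports Defs
begin

text \<open>The characteristic polynomial of the recurrence is $2x^3 + x^2 + x - 1 = (2x - 1)(x^2 + x + 1)$,
  so every solution is a combination of the powers of $1/2$ and two shifts of \<open>Omega\<close>. The first
  formula is such a combination with the right initial values, and
  $\Omega_{n-1} = -\Omega_n - \Omega_{n+1}$ turns it into the second.\<close>

lemma Omega_0 [simp]: "Omega 0 = 0"
  by (simp add: Omega_def)

lemma Omega_1 [simp]: "Omega 1 = 1"
  using omega1_neq_omega2 by (simp add: Omega_def)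

text \<open>Multiply \<open>w^2 + w + 1 = 0\<close> by \<open>w powi (n - 1)\<close>. As 0 is not a
  root, exponents add for negative \<open>n\<close> too.\<close>

lemma powi_root_recurrence:
  fixes w :: complex
  assumes "w^2 + w + 1 = 0"
  shows "w powi (n + 1) = - (w powi n) - w powi (n - 1)"
proof -
  have w: "w \<noteq> 0"
    using assms by auto
  have "w powi (n + 1) = w powi (n - 1) * w^2"
    and "w powi n = w powi (n - 1) * w"
    using power_int_add[of w "n - 1" 2] power_int_add[of w "n - 1" 1] w by (simp_all add: add.commute)
  then show ?thesis
    using assms by algebra
qed

lemma Omega_recurrence: "Omega (n + 1) = - Omega n - Omega (n - 1)"
proof -
  have "omega1 powi (n + 1) = - (omega1 powi n) - omega1 powi (n - 1)"
    and "omega2 powi (n + 1) = - (omega2 powi n) - omega2 powi (n - 1)"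
    using omega_roots by (blast intro: powi_root_recurrence)+
  then show ?thesis
    by (simp add: Omega_def diff_divide_distrib)
qed

text \<open>Starting at \<open>n = 0\<close> lets the induction follow the defining equations of
  \<open>Jg_neg\<close>, with the three initial values as base cases.\<close>

lemma Jg_neg_eq_Omega:
  "Jg_neg a b c n = 1/7 *
      (complex_of_real (a + b + c) * (1 + \<i>/2) * (1/2)^n
       - (complex_of_real (4*a + 4*b - 3*c) + complex_of_real (2*a - 5*b + 2*c) * \<i>) * Omega (int n)
       - (complex_of_real (6*a - b - c) - complex_of_real (4*a + 4*b - 3*c) * \<i>) * Omega (int n - 1))"
proof (induction a b c n rule: Jg_neg.induct)
  case (1 a b c)
  \<comment> \<open>At \<open>n = 0\<close> the formula reaches index -1; the recurrence, read
    backwards, gives the value there.\<close>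
  have "Omega (- 1) = - 1"
    using Omega_recurrence[of 0] by (simp add: minus_equation_iff)
  then show ?case
    by (simp add: complex_eq_iff field_simps)
next
  case (2 a b c)
  show ?case
    by (simp add: complex_eq_iff field_simps)
next
  case (3 a b c)
  have "Omega 2 = - 1"
    using Omega_recurrence[of 1] by simp
  then show ?case
    by (simp add: complex_eq_iff field_simps power2_eq_square)
next
  case (4 a b c n)
  \<comment> \<open>\<open>Omega\<close> has period 3, so \<open>x\<close>, \<open>y\<close> and
    \<open>- x - y\<close> are all the values that occur in the four instances of the
    formula.\<close>
  define x where "x = Omega (int n)"
  define y where "y = Omega (int n - 1)"
  have s1: "Omega (int (Suc n)) = - x - y"
    using Omega_recurrence[of "int n"] by (simp add: x_def y_def add.commute)
  have s2: "Omega (int (Suc (Suc n))) = y"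
    using Omega_recurrence[of "int n + 1"] s1 by (simp add: x_def add.commute)
  have s3: "Omega (int (Suc (Suc (Suc n)))) = x"
    using Omega_recurrence[of "int n + 2"] s1 s2 by (simp add: add.commute)
  have d: "int (Suc m) - 1 = int m" for m
    by simp
  show ?case
    \<comment> \<open>What remains is an identity linear in \<open>x\<close>, \<open>y\<close> and
      \<open>(1/2)^n\<close>.\<close>
    unfolding Jg_neg.simps(4) 4 d s1 s2 s3 x_def[symmetric] y_def[symmetric] power_Suc
    by (simp add: field_simps)
qed

theorem theorem2p6:
  fixes a b c :: real and n :: nat
  assumes "\<not> (a = 0 \<and> b = 0 \<and> c = 0)"
    and "n \<ge> 1"
  shows "Jg_neg a b c n = 1/7 *
      (complex_of_real (a + b + c) * (1 + \<i>/2) * (1/2)^n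
       - (complex_of_real (4*a + 4*b - 3*c) + complex_of_real (2*a - 5*b + 2*c) * \<i>) * Omega (int n)
       - (complex_of_real (6*a - b - c) - complex_of_real (4*a + 4*b - 3*c) * \<i>) * Omega (int n - 1))
    \<and> Jg_neg a b c n = 1/7 *
      (complex_of_real (a + b + c) * (1 + \<i>/2) * (1/2)^n
       + (complex_of_real (2*a - 5*b + 2*c) - complex_of_real (6*a - b - c) * \<i>) * Omega (int n)
       + (complex_of_real (6*a - b - c) - complex_of_real (4*a + 4*b - 3*c) * \<i>) * Omega (int n + 1))"
proof
  have prev: "Omega (int n - 1) = - Omega (int n) - Omega (int n + 1)"
    using Omega_recurrence[of "int n"] by simp
  show "Jg_neg a b c n = 1/7 *
      (complex_of_real (a + b + c) * (1 + \<i>/2) * (1/2)^n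
       + (complex_of_real (2*a - 5*b + 2*c) - complex_of_real (6*a - b - c) * \<i>) * Omega (int n)
       + (complex_of_real (6*a - b - c) - complex_of_real (4*a + 4*b - 3*c) * \<i>) * Omega (int n + 1))"
    \<comment> \<open>With P = 4a+4b-3c, Q = 2a-5b+2c and R = 6a-b-c we have R - P = Q, so the
      coefficient of \<open>Omega (int n)\<close> becomes -(P + Qi) + (R - Pi) = Q - Ri.\<close>
    unfolding Jg_neg_eq_Omega prev by (simp add: field_simps)
qed (rule Jg_neg_eq_Omega)

end
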